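(* Let $d \ge 1$ and let $S$ be a $d$-simplex complex in $\mathbb{R}^d$ (finite or infinite). Then the simplices of $S$ can be colored with $d+1$ colors so that any two simplices of $S$ that share a $(d-1)$-dimensional facet receive different colors. Equivalently, the dual graph of $S$ has chromatic number at most $d+1$.
   Context: A $d$-simplex complex in $\mathbb{R}^d$ is a pure (homogeneous) geometric simplicial complex in $\mathbb{R}^d$: a collection (possibly infinite) of non-degenerate $d$-dimensional simplices in $\mathbb{R}^d$, any two of which intersect in a common face (possibly empty), so that there are no lower-dimensional pieces not belonging to some $d$-simplex. A facet of a $d$-simplex is one of its $(d-1)$-dimensional faces. The dual graph of $S$ has one node per simplex of $S$, with two nodes adjacent iff the corresponding simplices share a whole $(d-1)$-dimensional facet. *)

theory Defs
  imports "HOL-Analysis.Analysis" "HOL-Library.Extended_Nat"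
begin

text \<open>The complex is given by its top-dimensional simplices; purity means that every lower-dimensional
  piece is a face of one of them.\<close>

definition simplex_complex :: "(real ^ 'n) set set \<Rightarrow> bool" where
  "simplex_complex S \<longleftrightarrow>
     (\<forall>T\<in>S. int CARD('n) simplex T) \<and>
     (\<forall>T\<in>S. \<forall>T'\<in>S. (T \<inter> T') face_of T \<and> (T \<inter> T') face_of T')"

definition share_facet :: "(real ^ 'n) set \<Rightarrow> (real ^ 'n) set \<Rightarrow> bool" where
  "share_facet T T' \<longleftrightarrow> T \<noteq> T' \<and> (\<exists>F. F facet_of T \<and> F facet_of T')"

text \<open>A simple graph is a pair of a vertex set and a set of two-element edges.\<close>

type_synonym 'v sgraph = "'v set \<times> 'v set set"

definition dual_graph :: "(real ^ 'n) set set \<Rightarrow> (real ^ 'n) set sgraph" where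
  "dual_graph S = (S, {{T, T'} | T T'. T \<in> S \<and> T' \<in> S \<and> share_facet T T'})"

definition proper_coloring :: "'v sgraph \<Rightarrow> nat \<Rightarrow> ('v \<Rightarrow> nat) \<Rightarrow> bool" where
  "proper_coloring G k c \<longleftrightarrow>
     c ` fst G \<subseteq> {..<k} \<and> (\<forall>u v. {u, v} \<in> snd G \<longrightarrow> c u \<noteq> c v)"

text \<open>The value is \<open>\<infinity>\<close> if no finite number of colors suffices.\<close>

definition chromatic_number :: "'v sgraph \<Rightarrow> enat" where
  "chromatic_number G = Inf {enat k | k. \<exists>c. proper_coloring G k c}"

end

theory Submission
  imports Defs
begin

text \<open>Near a relative interior point of a facet, each full-dimensional convex body having that facet
  fills one of the two half-balls cut off by the facet's hyperplane. Hence at most two simplices of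
  the complex share a given facet, and if two do, then relative interior points of the facet are
  interior to their union. In a finite subcomplex some facet is therefore unshared: leave the union
  along a segment that is generic in the sense of avoiding all faces of codimension two; the last
  point of the union on it lies in the relative interior of such a facet. The simplex
  with this facet has at most \<open>d\<close> neighbours, so finite subgraphs of the dual graph are
  \<open>d\<close>-degenerate and greedily \<open>(d + 1)\<close>-colourable. Compactness of the space of colourings extends
  this to infinite complexes.\<close>

section \<open>Colouring degenerate graphs and passing to infinite graphs\<close>

text \<open>Induction: delete a vertex with fewer than \<open>k\<close> neighbours, colour the rest,
  and give it a colour absent among its neighbours. The degree hypothesis ranges over all subsets so
  that it survives the deletion.\<close>

lemma finite_degenerate_coloring:
  fixes E :: "'v \<Rightarrow> 'v \<Rightarrow> bool"
  assumes "finite V" and sym: "\<And>u v. E u v \<Longrightarrow> E v u" and irrefl: "\<And>v. \<not> E v v"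
    and deg: "\<And>A. A \<subseteq> V \<Longrightarrow> A \<noteq> {} \<Longrightarrow> \<exists>v\<in>A. card {u \<in> A. E v u} < k"
  shows "\<exists>c. (\<forall>v\<in>V. c v < k) \<and> (\<forall>u\<in>V. \<forall>v\<in>V. E u v \<longrightarrow> c u \<noteq> c v)"
  using \<open>finite V\<close> deg
proof (induction V rule: finite_psubset_induct)
  case (psubset V)
  show ?case
  proof (cases "V = {}")
    case False
    then obtain v where v: "v \<in> V" "card {u \<in> V. E v u} < k"
      using psubset.prems[of V] by blast
    obtain c where c: "\<forall>u\<in>V - {v}. c u < k"
        "\<forall>u\<in>V - {v}. \<forall>w\<in>V - {v}. E u w \<longrightarrow> c u \<noteq> c w"
      using psubset.IH[of "V - {v}"] psubset.prems v(1) by blast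
    have "card (c ` {u \<in> V. E v u}) < card {..<k}"
      using v(2) card_image_le[of "{u \<in> V. E v u}" c] psubset.hyps by simp
    then have "\<not> {..<k} \<subseteq> c ` {u \<in> V. E v u}"
      using card_mono[of "c ` {u \<in> V. E v u}" "{..<k}"] psubset.hyps by auto
    then obtain i where i: "i < k" "i \<notin> c ` {u \<in> V. E v u}"
      by blast
    have "\<forall>u\<in>V. (c(v := i)) u < k"
      using c(1) i(1) by simp
    moreover have "\<forall>u\<in>V. \<forall>w\<in>V. E u w \<longrightarrow> (c(v := i)) u \<noteq> (c(v := i)) w"
      using c(2) i(2) sym irrefl by auto
    ultimately show ?thesis
      by blast
  qed simp
qed

text \<open>Colourings form a product of finite discrete spaces, compact by Tychonoff. Each pair of
  vertices imposes a closed condition, and finitely many conditions involve only finitely many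
  vertices, so \<open>fin\<close> gives the finite intersection property.\<close>

lemma de_Bruijn_Erdos:
  fixes E :: "'v \<Rightarrow> 'v \<Rightarrow> bool"
  assumes fin: "\<And>A. finite A \<Longrightarrow> A \<subseteq> V \<Longrightarrow>
      \<exists>c. (\<forall>v\<in>A. c v < k) \<and> (\<forall>u\<in>A. \<forall>v\<in>A. E u v \<longrightarrow> c u \<noteq> c v)"
  shows "\<exists>c :: 'v \<Rightarrow> nat. (\<forall>v\<in>V. c v < k) \<and> (\<forall>u\<in>V. \<forall>v\<in>V. E u v \<longrightarrow> c u \<noteq> c v)"
proof (cases "V = {}")
  case False
  then obtain v0 where "v0 \<in> V" by blast
  \<comment> \<open>This makes 0 a legal default colour in \<open>c'\<close> below.\<close>
  then have "0 < k"
    using fin[of "{v0}"] by auto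
  define X where "X = product_topology (\<lambda>_::'v. discrete_topology {..<k}) V"
  define C where "C = (\<lambda>(u, v). {c \<in> topspace X. E u v \<longrightarrow> c u \<noteq> c v})"
  have "compact_space X"
    by (simp add: X_def compact_space_product_topology compact_space_discrete_topology)
  have closed: "closedin X (C p)" if "p \<in> V \<times> V" for p
  proof -
    from that obtain u v where p: "p = (u, v)" "u \<in> V" "v \<in> V"
      by auto
    have pre: "closedin X {c \<in> topspace X. c w \<in> I}" if "w \<in> V" "I \<subseteq> {..<k}" for w I
      using closedin_continuous_map_preimage[of X "discrete_topology {..<k}" "\<lambda>c. c w" I] that
        continuous_map_product_projection[of w V "\<lambda>_. discrete_topology {..<k}"]
      by (simp add: X_def)
    \<comment> \<open>Splitting by the colour \<open>i\<close> of \<open>u\<close> turns the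
      condition into a finite union of intersections of preimages under coordinate projections,
      hence a closed set.\<close>
    have "C p = (if E u v then \<Union>i\<in>{..<k}. {c \<in> topspace X. c u \<in> {i}} \<inter>
        {c \<in> topspace X. c v \<in> {..<k} - {i}} else topspace X)"
      using p by (auto simp: C_def X_def PiE_def Pi_def)
    moreover have "closedin X ({c \<in> topspace X. c u \<in> {i}} \<inter>
        {c \<in> topspace X. c v \<in> {..<k} - {i}})" if "i < k" for i
      using that by (intro closedin_Int pre p) auto
    then have "closedin X (\<Union>i\<in>{..<k}. {c \<in> topspace X. c u \<in> {i}} \<inter>
        {c \<in> topspace X. c v \<in> {..<k} - {i}})"
      by (intro closedin_Union) blast+
    ultimately show ?thesis
      by simp
  qed
  have fip: "\<Inter>\<F> \<noteq> {}" if "finite \<F>" "\<F> \<subseteq> C ` (V \<times> V)" for \<F>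
  proof -
    from finite_subset_image[OF that]
    obtain P where P: "finite P" "P \<subseteq> V \<times> V" "\<F> = C ` P"
      by blast
    define A where "A = fst ` P \<union> snd ` P"
    have "finite A" "A \<subseteq> V"
      using P by (auto simp: A_def)
    from fin[OF this] obtain c where c: "\<forall>v\<in>A. c v < k" "\<forall>u\<in>A. \<forall>v\<in>A. E u v \<longrightarrow> c u \<noteq> c v"
      by blast
    \<comment> \<open>Points of the product space are functions on all of \<open>V\<close>,
      undefined elsewhere, so the colouring of \<open>A\<close> is padded with 0 on the rest of
      \<open>V\<close>.\<close>
    define c' where "c' = (\<lambda>v\<in>V. if v \<in> A then c v else 0)"
    have "c' \<in> topspace X"
      using c(1) \<open>0 < k\<close> by (auto simp: X_def c'_def)
    moreover have "c' u \<noteq> c' v" if "(u, v) \<in> P" "E u v" for u v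
    proof -
      have "u \<in> A" "v \<in> A"
        using that(1) by (force simp: A_def)+
      then show ?thesis
        using c(2) that(2) \<open>A \<subseteq> V\<close> by (auto simp: c'_def)
    qed
    ultimately have "c' \<in> \<Inter>\<F>"
      by (auto simp: P(3) C_def)
    then show ?thesis
      by blast
  qed
  have "\<Inter>(C ` (V \<times> V)) \<noteq> {}"
    using \<open>compact_space X\<close>[unfolded compact_space_fip, rule_format, of "C ` (V \<times> V)"] closed fip
    by blast
  then obtain c where c: "\<And>u v. u \<in> V \<Longrightarrow> v \<in> V \<Longrightarrow> c \<in> C (u, v)"
    by blast
  then have "c \<in> topspace X"
    using \<open>v0 \<in> V\<close> by (force simp: C_def)
  then have "\<forall>v\<in>V. c v < k"
    by (auto simp: X_def)
  moreover have "\<forall>u\<in>V. \<forall>v\<in>V. E u v \<longrightarrow> c u \<noteq> c v"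
    using c by (auto simp: C_def)
  ultimately show ?thesis
    by blast
qed simp

section \<open>Convex bodies near a relative interior point of a facet\<close>

text \<open>A point \<open>x\<close> near \<open>p\<close> on the side of \<open>z\<close> lies on a
  segment from \<open>z\<close> to some \<open>y x\<close> in the hyperplane. As \<open>x\<close>
  tends to \<open>p\<close>, so does \<open>y x\<close>, which therefore falls into
  \<open>F\<close>; convexity then puts \<open>x\<close> into \<open>T\<close>.\<close>

lemma half_ball_subset_if_affine_hull_hyperplane:
  fixes T :: "'a::euclidean_space set"
  assumes "convex T" "F \<subseteq> T" and aff: "affine hull F = {x. a \<bullet> x = b}"
    and p: "p \<in> rel_interior F" and z: "z \<in> T" "a \<bullet> z < b"
  shows "\<exists>e>0. ball p e \<inter> {x. a \<bullet> x \<le> b} \<subseteq> T"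
proof -
  obtain r where r: "r > 0" "ball p r \<inter> affine hull F \<subseteq> F" and "p \<in> F"
    using p by (auto simp: mem_rel_interior_ball)
  have "a \<bullet> p = b"
    using \<open>p \<in> F\<close> aff hull_inc[of p F] by auto
  \<comment> \<open>These solve \<open>x = (1 - t x) *\<^sub>R y x + t x *\<^sub>R z\<close> with
    \<open>a \<bullet> y x = b\<close>: \<open>y x\<close> is where the line through
    \<open>z\<close> and \<open>x\<close> meets the hyperplane.\<close>
  define t where "t = (\<lambda>x. (b - a \<bullet> x) / (b - a \<bullet> z))"
  define y where "y = (\<lambda>x. (1 / (1 - t x)) *\<^sub>R (x - t x *\<^sub>R z))"
  have [simp]: "t p = 0" "y p = p"
    using \<open>a \<bullet> p = b\<close> by (auto simp: t_def y_def)
  have "isCont t p"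
    unfolding t_def using z by (intro continuous_intros) auto
  moreover have "isCont y p"
    unfolding y_def using \<open>isCont t p\<close> by (intro continuous_intros) auto
  ultimately have "(t \<longlongrightarrow> 0) (nhds p)" "(y \<longlongrightarrow> p) (nhds p)"
    using tendsto_at_iff_tendsto_nhds[of t p] tendsto_at_iff_tendsto_nhds[of y p]
    by (simp_all add: isCont_def)
  then have "\<forall>\<^sub>F x in nhds p. t x < 1" "\<forall>\<^sub>F x in nhds p. dist (y x) p < r"
    using order_tendstoD(2)[of t 0 "nhds p" 1] tendstoD[of y p "nhds p" r] \<open>r > 0\<close> by auto
  then have "\<forall>\<^sub>F x in nhds p. t x < 1 \<and> dist (y x) p < r"
    by (rule eventually_conj)
  then obtain e where e: "e > 0" "\<And>x. dist x p < e \<Longrightarrow> t x < 1 \<and> dist (y x) p < r"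
    by (auto simp: eventually_nhds_metric)
  have "x \<in> T" if "x \<in> ball p e" "a \<bullet> x \<le> b" for x
  proof -
    have tx: "t x < 1" "dist (y x) p < r"
      using e(2)[of x] that by (auto simp: dist_commute)
    have "t x \<ge> 0"
      using that z by (auto simp: t_def)
    have "t x * (b - a \<bullet> z) = b - a \<bullet> x"
      using z by (simp add: t_def)
    then have "a \<bullet> x - t x * (a \<bullet> z) = b * (1 - t x)"
      by (simp add: algebra_simps)
    then have "a \<bullet> y x = b"
      using tx(1) by (simp add: y_def inner_diff_right)
    then have "y x \<in> T"
      using r(2) tx(2) aff \<open>F \<subseteq> T\<close> by (auto simp: dist_commute)
    moreover have "x = (1 - t x) *\<^sub>R y x + t x *\<^sub>R z"
      using tx(1) by (simp add: y_def)
    ultimately show ?thesis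
      using convexD_alt[OF \<open>convex T\<close>, of "y x" z "t x"] z(1) tx(1) \<open>t x \<ge> 0\<close> by simp
  qed
  then show ?thesis
    using e(1) by blast
qed

text \<open>Full dimension supplies a point of \<open>T\<close> off the hyperplane. The sign
  \<open>s\<close> encodes its side, so that bodies sharing \<open>F\<close> can be compared through
  their signs.\<close>

lemma facet_one_sided_ball:
  fixes T :: "'a::euclidean_space set"
  assumes "convex T" "aff_dim T = DIM('a)" "F \<subseteq> T" and aff: "affine hull F = {x. a \<bullet> x = b}"
    and "a \<noteq> 0" and p: "p \<in> rel_interior F"
  shows "\<exists>s\<in>{1, -1::real}. \<exists>e>0. ball p e \<inter> {x. s * (a \<bullet> x - b) \<le> 0} \<subseteq> T"
proof -
  have "\<not> T \<subseteq> {x. a \<bullet> x = b}"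
    using aff_dim_subset[of T "{x. a \<bullet> x = b}"] assms(2) \<open>a \<noteq> 0\<close> by auto
  then obtain z where z: "z \<in> T" "a \<bullet> z \<noteq> b"
    by blast
  show ?thesis
  proof (cases "a \<bullet> z < b")
    case True
    then show ?thesis
      using half_ball_subset_if_affine_hull_hyperplane[OF assms(1,3) aff p z(1)] by auto
  next
    case False
    then have "\<exists>e>0. ball p e \<inter> {x. (- a) \<bullet> x \<le> - b} \<subseteq> T"
      using half_ball_subset_if_affine_hull_hyperplane[OF assms(1,3) _ p z(1), of "-a" "-b"] aff z(2)
      by auto
    then show ?thesis
      by auto
  qed
qed

lemma interiors_meet_on_same_side:
  fixes T :: "'a::euclidean_space set"
  assumes "a \<noteq> 0" "a \<bullet> p = b" "s \<in> {1, -1::real}" "e > 0" "e' > 0"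
    and T: "ball p e \<inter> {x. s * (a \<bullet> x - b) \<le> 0} \<subseteq> T"
    and T': "ball p e' \<inter> {x. s * (a \<bullet> x - b) \<le> 0} \<subseteq> T'"
  shows "interior T \<inter> interior T' \<noteq> {}"
proof -
  define W where "W = ball p (min e e') \<inter> {x. (s *\<^sub>R a) \<bullet> x < s * b}"
  have "open W"
    unfolding W_def by (intro open_Int open_ball open_halfspace_lt)
  moreover have "W \<subseteq> T" "W \<subseteq> T'"
    using T T' by (auto simp: W_def algebra_simps)
  ultimately have "W \<subseteq> interior T \<inter> interior T'"
    by (simp add: interior_maximal)
  \<comment> \<open>Moving from \<open>p\<close> along the normal by half the smaller radius,
    towards the side given by \<open>s\<close>, yields a point of the open half-ball
    \<open>W\<close>.\<close>
  define r where "r = min e e' / (2 * norm a)"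
  have "r > 0"
    using assms(1,4,5) by (simp add: r_def)
  have "norm (s * r) * norm a < min e e'"
    using assms(1,3,4,5) by (auto simp: r_def)
  moreover have "(s *\<^sub>R a) \<bullet> (p - (s * r) *\<^sub>R a) = s * b - r * (a \<bullet> a)"
    using assms(2,3) by (auto simp: inner_diff_right algebra_simps)
  moreover have "r * (a \<bullet> a) > 0"
    using \<open>r > 0\<close> \<open>a \<noteq> 0\<close> by simp
  ultimately have "p - (s * r) *\<^sub>R a \<in> W"
    by (auto simp: W_def dist_norm)
  then show ?thesis
    using \<open>W \<subseteq> interior T \<inter> interior T'\<close> by blast
qed

lemma facet_affine_hull_hyperplane:
  fixes T :: "'a::euclidean_space set"
  assumes "F facet_of T" "aff_dim T = DIM('a)"
  obtains a b where "a \<noteq> 0" "affine hull F = {x. a \<bullet> x = b}"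
proof -
  have "aff_dim F = DIM('a) - 1"
    using assms by (simp add: facet_of_def)
  then show thesis
    using that aff_dim_eq_hyperplane[of F] by auto
qed

text \<open>Pigeonhole: a hyperplane has two sides, so two of the three bodies fill the same side
  near a relative interior point of \<open>F\<close>.\<close>

lemma shared_facet_unique:
  fixes T1 T2 T3 :: "'a::euclidean_space set"
  assumes "convex T1" "convex T2" "convex T3"
    and dim: "aff_dim T1 = DIM('a)" "aff_dim T2 = DIM('a)" "aff_dim T3 = DIM('a)"
    and F: "F facet_of T1" "F facet_of T2" "F facet_of T3"
  shows "interior T1 \<inter> interior T2 \<noteq> {} \<or> interior T1 \<inter> interior T3 \<noteq> {} \<or>
    interior T2 \<inter> interior T3 \<noteq> {}"
proof -
  obtain a b where ab: "a \<noteq> 0" "affine hull F = {x. a \<bullet> x = b}"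
    using facet_affine_hull_hyperplane[OF F(1) dim(1)] .
  have "convex F" "F \<noteq> {}"
    using F(1) by (auto simp: facet_of_def face_of_imp_convex)
  then obtain p where p: "p \<in> rel_interior F"
    using rel_interior_eq_empty by blast
  then have "a \<bullet> p = b"
    using ab(2) hull_inc[of p F] rel_interior_subset by blast
  obtain s1 e1 where 1: "s1 \<in> {1, -1::real}" "e1 > 0" "ball p e1 \<inter> {x. s1 * (a \<bullet> x - b) \<le> 0} \<subseteq> T1"
    using facet_one_sided_ball[OF assms(1) dim(1) facet_of_imp_subset[OF F(1)] ab(2,1) p] by blast
  obtain s2 e2 where 2: "s2 \<in> {1, -1::real}" "e2 > 0" "ball p e2 \<inter> {x. s2 * (a \<bullet> x - b) \<le> 0} \<subseteq> T2"
    using facet_one_sided_ball[OF assms(2) dim(2) facet_of_imp_subset[OF F(2)] ab(2,1) p] by blast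
  obtain s3 e3 where 3: "s3 \<in> {1, -1::real}" "e3 > 0" "ball p e3 \<inter> {x. s3 * (a \<bullet> x - b) \<le> 0} \<subseteq> T3"
    using facet_one_sided_ball[OF assms(3) dim(3) facet_of_imp_subset[OF F(3)] ab(2,1) p] by blast
  consider "s1 = s2" | "s1 = s3" | "s2 = s3"
    using 1(1) 2(1) 3(1) by auto
  then show ?thesis
    using 1 2 3 interiors_meet_on_same_side[OF ab(1) \<open>a \<bullet> p = b\<close>] by cases metis+
qed

text \<open>Disjoint interiors force opposite sides, and the two closed half-balls together cover a
  full ball around the point.\<close>

lemma rel_interior_shared_facet_subset_interior_Un:
  fixes T :: "'a::euclidean_space set"
  assumes "convex T" "convex T'" and dim: "aff_dim T = DIM('a)" "aff_dim T' = DIM('a)"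
    and F: "F facet_of T" "F facet_of T'" and disj: "interior T \<inter> interior T' = {}"
  shows "rel_interior F \<subseteq> interior (T \<union> T')"
proof
  fix p assume p: "p \<in> rel_interior F"
  obtain a b where ab: "a \<noteq> 0" "affine hull F = {x. a \<bullet> x = b}"
    using facet_affine_hull_hyperplane[OF F(1) dim(1)] .
  have "a \<bullet> p = b"
    using p ab(2) hull_inc[of p F] rel_interior_subset by blast
  obtain s e where 1: "s \<in> {1, -1::real}" "e > 0" "ball p e \<inter> {x. s * (a \<bullet> x - b) \<le> 0} \<subseteq> T"
    using facet_one_sided_ball[OF assms(1) dim(1) facet_of_imp_subset[OF F(1)] ab(2,1) p] by blast
  obtain s' e' where 2: "s' \<in> {1, -1::real}" "e' > 0" "ball p e' \<inter> {x. s' * (a \<bullet> x - b) \<le> 0} \<subseteq> T'"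
    using facet_one_sided_ball[OF assms(2) dim(2) facet_of_imp_subset[OF F(2)] ab(2,1) p] by blast
  have "s' = - s"
    using 1 2 interiors_meet_on_same_side[OF ab(1) \<open>a \<bullet> p = b\<close>, of s e e' T T'] disj by auto
  have "ball p (min e e') \<subseteq> T \<union> T'"
  proof
    fix x assume x: "x \<in> ball p (min e e')"
    have "s * (a \<bullet> x - b) \<le> 0 \<or> s' * (a \<bullet> x - b) \<le> 0"
      unfolding \<open>s' = - s\<close> by auto
    then show "x \<in> T \<union> T'"
      using x 1(3) 2(3) by auto
  qed
  then show "p \<in> interior (T \<union> T')"
    using 1(2) 2(2) by (auto simp: mem_interior intro!: exI[of _ "min e e'"])
qed

section \<open>Unshared facets in finite families of polytopes\<close>

text \<open>One extra point raises the affine dimension by at most one, so the hull still fits into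
  a hyperplane, a null set.\<close>

lemma negligible_affine_hull_insert:
  fixes G :: "'a::euclidean_space set"
  assumes "aff_dim G + 1 < DIM('a)"
  shows "negligible (affine hull (insert x G))"
proof -
  have "aff_dim (insert x G) < DIM('a)"
    using assms by (simp add: aff_dim_insert)
  then obtain a b where ab: "a \<noteq> 0" "affine hull (insert x G) \<subseteq> {x. a \<bullet> x = b}"
    using aff_lowdim_subset_hyperplane[of "affine hull (insert x G)"] by auto
  then show ?thesis
    using negligible_hyperplane[of a b] negligible_subset by blast
qed

text \<open>If every facet were shared, the last point of the union on a generic segment leaving it
  would be forced onto a codimension-two face, against genericity.\<close>

lemma exists_unshared_facet:
  fixes S :: "'a::euclidean_space set set"
  assumes "finite S" "S \<noteq> {}"
    and poly: "\<And>T. T \<in> S \<Longrightarrow> polytope T" and dim: "\<And>T. T \<in> S \<Longrightarrow> aff_dim T = DIM('a)"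
    and disj: "\<And>T T'. T \<in> S \<Longrightarrow> T' \<in> S \<Longrightarrow> T \<noteq> T' \<Longrightarrow> interior T \<inter> interior T' = {}"
  shows "\<exists>T\<in>S. \<exists>F. F facet_of T \<and> (\<forall>T'\<in>S. F facet_of T' \<longrightarrow> T' = T)"
proof (rule ccontr)
  assume "\<not> ?thesis"
  then have shared: "\<And>T F. T \<in> S \<Longrightarrow> F facet_of T \<Longrightarrow> \<exists>T'\<in>S. F facet_of T' \<and> T' \<noteq> T"
    by blast
  have "compact (\<Union>S)"
    using \<open>finite S\<close> poly polytope_imp_compact by (blast intro: compact_Union)
  then obtain x where x: "x \<notin> \<Union>S"
    using not_compact_UNIV by (metis UNIV_eq_I)
  \<comment> \<open>The codimension-two faces, as facets of facets. In dimension one there are none,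
    since facets are nonempty.\<close>
  define \<G> where "\<G> = (\<Union>T\<in>S. \<Union>F\<in>{F. F facet_of T}. {G. G facet_of F})"
  have "finite \<G>"
    unfolding \<G>_def
  proof (intro finite_UN_I \<open>finite S\<close>)
    fix T F assume "T \<in> S" "F \<in> {F. F facet_of T}"
    then have "polytope F"
      using poly facet_of_imp_face_of face_of_polytope_polytope by blast
    then show "finite {G. G facet_of F}"
      by (rule finite_polytope_facets)
  qed (use poly finite_polytope_facets in blast)
  have "negligible (affine hull (insert x G))" if "G \<in> \<G>" for G
    using that dim by (intro negligible_affine_hull_insert) (auto simp: \<G>_def facet_of_def)
  then have neg: "negligible (\<Union>G\<in>\<G>. affine hull (insert x G))"
    using \<open>finite \<G>\<close> by (intro negligible_Union) auto
  \<comment> \<open>The line from \<open>x\<close> through a point of a codimension-two face \<open>G\<close> stays in the affine hull of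
    \<open>insert x G\<close>, so a segment starting outside these null sets meets no such face.\<close>
  obtain T0 where "T0 \<in> S"
    using \<open>S \<noteq> {}\<close> by blast
  \<comment> \<open>A nonempty open set is not null, so the finitely many null hulls cannot cover
    the interior of \<open>T0\<close>.\<close>
  then have "interior T0 \<noteq> {}"
    using poly[of T0] dim[of T0] polytope_imp_convex[of T0] rel_interior_eq_empty[of T0]
    by (auto simp: interior_rel_interior_gen)
  then have "\<not> negligible (interior T0)"
    by (simp add: open_not_negligible)
  then obtain y where y: "y \<in> interior T0" "\<And>G. G \<in> \<G> \<Longrightarrow> y \<notin> affine hull (insert x G)"
    using neg negligible_subset by (metis (no_types, lifting) UN_I subsetI)
  have "y \<in> \<Union>S"
    using y(1) \<open>T0 \<in> S\<close> interior_subset by blast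
  have "closed (\<Union>S \<inter> closed_segment y x)"
    using \<open>compact (\<Union>S)\<close> by (intro closed_Int) (auto intro: compact_imp_closed)
  moreover have "\<Union>S \<inter> closed_segment y x \<noteq> {}"
    using \<open>y \<in> \<Union>S\<close> ends_in_segment(1)[of y x] by blast
  \<comment> \<open>The point of the union on the segment nearest to \<open>x\<close> is the last
    one met on the way from \<open>y\<close> to \<open>x\<close>.\<close>
  ultimately obtain q where q_in: "q \<in> \<Union>S \<inter> closed_segment y x"
      and min: "\<And>w. w \<in> \<Union>S \<inter> closed_segment y x \<Longrightarrow> dist x q \<le> dist x w"
    by (rule distance_attains_inf[where a = x]) blast
  then have q: "q \<in> \<Union>S" "q \<in> closed_segment y x"
    by simp_all
  have "q \<noteq> x"
    using q(1) x by blast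
  have "q \<notin> interior (\<Union>S)"
  proof
    assume "q \<in> interior (\<Union>S)"
    then obtain e where e: "e > 0" "ball q e \<subseteq> \<Union>S"
      by (auto simp: mem_interior)
    \<comment> \<open>A step from an interior \<open>q\<close> towards \<open>x\<close> would stay
      in the union but come closer to \<open>x\<close>. The bound 1 keeps \<open>w\<close> on the
      segment, the other bound keeps it within \<open>e / 2\<close> of \<open>q\<close>.\<close>
    define t where "t = min 1 (e / (2 * dist x q))"
    have t: "0 < t" "t \<le> 1" "t * dist x q < e"
      using e(1) \<open>q \<noteq> x\<close> by (auto simp: t_def min_def field_simps)
    define w where "w = (1 - t) *\<^sub>R q + t *\<^sub>R x"
    have "w \<in> closed_segment q x"
      using t by (auto simp: w_def in_segment intro!: exI[of _ t])
    then have "w \<in> closed_segment y x"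
      using q(2) subset_closed_segment[of q x y x] by auto
    moreover have "w - q = t *\<^sub>R (x - q)" "x - w = (1 - t) *\<^sub>R (x - q)"
      by (auto simp: w_def algebra_simps)
    then have d: "dist q w = t * dist x q" "dist x w = (1 - t) * dist x q"
      using t by (simp_all add: dist_norm norm_minus_commute[of q w])
    moreover have "w \<in> \<Union>S"
      using subsetD[OF e(2), of w] t(3) d(1) by simp
    ultimately have "dist x q \<le> (1 - t) * dist x q"
      by (metis IntI min)
    then show False
      using t(1) \<open>q \<noteq> x\<close> by (simp add: algebra_simps mult_le_0_iff)
  qed
  obtain T where T: "T \<in> S" "q \<in> T"
    using q(1) by blast
  have "q \<notin> interior T"
    using \<open>q \<notin> interior (\<Union>S)\<close> interior_mono[of T "\<Union>S"] T(1) by blast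
  \<comment> \<open>The relative frontier of a polytope is the union of its facets. This is applied
    to \<open>T\<close> to find \<open>F\<close>, and below to \<open>F\<close> to find
    \<open>G\<close>.\<close>
  then have "q \<in> rel_frontier T"
    using T closure_subset[of T] dim[of T] interior_rel_interior_gen[of T]
    by (auto simp: rel_frontier_def)
  then obtain F where F: "F facet_of T" "q \<in> F"
    using rel_frontier_of_polyhedron[of T] poly[OF T(1)] polytope_imp_polyhedron[of T] by blast
  obtain T' where T': "T' \<in> S" "F facet_of T'" "T' \<noteq> T"
    using shared[OF T(1) F(1)] by blast
  \<comment> \<open>Since \<open>F\<close> is shared, its relative interior is interior to the
    union, where \<open>q\<close> does not lie; hence \<open>q\<close> is on the relative frontier
    of \<open>F\<close>.\<close>
  have "rel_interior F \<subseteq> interior (T \<union> T')"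
    using T(1) T' F(1) poly[THEN polytope_imp_convex] dim disj[of T T']
    by (intro rel_interior_shared_facet_subset_interior_Un) simp_all
  also have "\<dots> \<subseteq> interior (\<Union>S)"
    using T(1) T'(1) by (intro interior_mono) auto
  finally have "q \<in> rel_frontier F"
    using \<open>q \<notin> interior (\<Union>S)\<close> F(2) closure_subset[of F] by (auto simp: rel_frontier_def)
  moreover have "polyhedron F"
    using poly[OF T(1)] F(1) facet_of_imp_face_of face_of_polytope_polytope polytope_imp_polyhedron
    by blast
  ultimately obtain G where G: "G facet_of F" "q \<in> G"
    using rel_frontier_of_polyhedron[of F] by blast
  then have "G \<in> \<G>"
    using T(1) F(1) by (auto simp: \<G>_def)
  \<comment> \<open>Because \<open>q \<noteq> x\<close>, the segment equation can be solved for
    \<open>y\<close>, making \<open>y\<close> an affine combination of \<open>q\<close> in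
    \<open>G\<close> and \<open>x\<close>.\<close>
  obtain t where t: "0 \<le> t" "t \<le> 1" "q = (1 - t) *\<^sub>R y + t *\<^sub>R x"
    using q(2) by (auto simp: in_segment)
  then have "t \<noteq> 1"
    using \<open>q \<noteq> x\<close> by auto
  have "(1 - t) *\<^sub>R y = q - t *\<^sub>R x"
    using t(3) by simp
  then have "y = (1 / (1 - t)) *\<^sub>R (q - t *\<^sub>R x)"
    using \<open>t \<noteq> 1\<close> by (simp flip: \<open>(1 - t) *\<^sub>R y = q - t *\<^sub>R x\<close>)
  then have "y = (1 / (1 - t)) *\<^sub>R q + (- t / (1 - t)) *\<^sub>R x"
    by (simp add: scaleR_diff_right)
  moreover have "1 / (1 - t) + - t / (1 - t) = 1"
    using \<open>t \<noteq> 1\<close> by (simp add: field_simps)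
  ultimately have "y \<in> affine hull (insert x G)"
    using mem_affine[OF affine_affine_hull, of q "insert x G" x "1 / (1 - t)" "- t / (1 - t)"] G(2)
    by (simp add: hull_inc)
  then show False
    using y(2) \<open>G \<in> \<G>\<close> by blast
qed

section \<open>Degrees in the dual graph of a simplex complex\<close>

text \<open>A face meeting the interior of a convex set is the whole set, so a common interior point
  makes the common face equal to both simplices.\<close>

lemma simplex_complex_interiors_disjoint:
  fixes S :: "(real ^ 'n) set set"
  assumes "simplex_complex S" "T \<in> S" "T' \<in> S" "T \<noteq> T'"
  shows "interior T \<inter> interior T' = {}"
proof (rule ccontr)
  assume ne: "interior T \<inter> interior T' \<noteq> {}"
  have "(T \<inter> T') face_of T" "(T \<inter> T') face_of T'"
    using assms by (auto simp: simplex_complex_def)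
  moreover have "T \<inter> T' \<inter> interior T \<noteq> {}" "T \<inter> T' \<inter> interior T' \<noteq> {}"
    using ne interior_subset by blast+
  ultimately have "T \<inter> T' = T" "T \<inter> T' = T'"
    using face_of_disjoint_interior by blast+
  then show False
    using \<open>T \<noteq> T'\<close> by simp
qed

text \<open>Take a simplex of \<open>A\<close> with an unshared facet. Sending each neighbour to a
  common facet is injective and misses the unshared one, leaving at most \<open>CARD('n)\<close>
  values.\<close>

lemma simplex_complex_low_degree:
  fixes S :: "(real ^ 'n) set set"
  assumes S: "simplex_complex S" and A: "finite A" "A \<noteq> {}" "A \<subseteq> S"
  shows "\<exists>T\<in>A. card {T' \<in> A. share_facet T T'} < CARD('n) + 1"
proof -
  have simp: "int CARD('n) simplex T" if "T \<in> A" for T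
    using S A that by (auto simp: simplex_complex_def)
  have poly: "polytope T" "convex T" "aff_dim T = DIM(real ^ 'n)" if "T \<in> A" for T
    using simp[OF that] by (auto simp: simplex_imp_polytope convex_simplex aff_dim_simplex)
  have disj: "interior T \<inter> interior T' = {}" if "T \<in> A" "T' \<in> A" "T \<noteq> T'" for T T'
    using simplex_complex_interiors_disjoint[OF S] A that by blast
  obtain T F where T: "T \<in> A" "F facet_of T" "\<forall>T'\<in>A. F facet_of T' \<longrightarrow> T' = T"
    using exists_unshared_facet[OF A(1,2) poly(1,3) disj] by blast
  obtain C where C: "finite C" "\<not> affine_dependent C" "card C = CARD('n) + 1" "T = convex hull C"
    using simp[OF T(1)] by (auto simp: simplex)
  \<comment> \<open>Each facet of a simplex omits exactly one vertex, which bounds their number by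
    that of the vertices.\<close>
  have "{F. F facet_of T} \<subseteq> (\<lambda>u. convex hull (C - {u})) ` C"
    using facet_of_convex_hull_affine_independent[OF C(2)] C(4) by blast
  then have facets: "card {F. F facet_of T} \<le> CARD('n) + 1"
    using surj_card_le[OF C(1)] C(3) by metis
  have fin: "finite {F. F facet_of T}"
    using poly(1)[OF T(1)] finite_polytope_facets by blast
  have "\<forall>T'\<in>{T' \<in> A. share_facet T T'}. \<exists>F'. F' facet_of T \<and> F' facet_of T'"
    by (auto simp: share_facet_def)
  then obtain f where f: "\<And>T'. T' \<in> A \<Longrightarrow> share_facet T T' \<Longrightarrow> f T' facet_of T \<and> f T' facet_of T'"
    by (metis (mono_tags, lifting) mem_Collect_eq)
  have inj: "inj_on f {T' \<in> A. share_facet T T'}"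
  proof (rule inj_onI, clarify)
    fix T1 T2 assume *: "T1 \<in> A" "share_facet T T1" "T2 \<in> A" "share_facet T T2" "f T1 = f T2"
    then have "T \<noteq> T1" "T \<noteq> T2"
      by (auto simp: share_facet_def)
    \<comment> \<open>Otherwise \<open>T\<close>, \<open>T1\<close> and \<open>T2\<close> would be
      three bodies with disjoint interiors on one facet.\<close>
    then show "T1 = T2"
      using shared_facet_unique[of T T1 T2 "f T1"] f[of T1] f[of T2] * T(1) poly(2,3) disj by metis
  qed
  have "f ` {T' \<in> A. share_facet T T'} \<subseteq> {F. F facet_of T} - {F}"
    using f T(3) by (auto simp: share_facet_def)
  then have "card {T' \<in> A. share_facet T T'} \<le> card ({F. F facet_of T} - {F})"
    using card_inj_on_le[OF inj] fin by blast
  also have "\<dots> < card {F. F facet_of T}"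
    using fin T(2) by (intro psubset_card_mono) auto
  finally show ?thesis
    using facets T(1) by force
qed

section \<open>From finite subcomplexes to a colouring of the whole dual graph\<close>

theorem theorem1:
  fixes S :: "(real ^ 'n) set set"
  assumes "simplex_complex S"
  shows "(\<exists>c :: (real ^ 'n) set \<Rightarrow> nat.
            (\<forall>T\<in>S. c T < CARD('n) + 1) \<and>
            (\<forall>T\<in>S. \<forall>T'\<in>S. share_facet T T' \<longrightarrow> c T \<noteq> c T'))
         \<and> chromatic_number (dual_graph S) \<le> enat (CARD('n) + 1)"
proof -
  have sym: "share_facet T T' \<Longrightarrow> share_facet T' T" for T T' :: "(real ^ 'n) set"
    by (auto simp: share_facet_def)
  have "\<exists>c. (\<forall>T\<in>A. c T < CARD('n) + 1) \<and> (\<forall>T\<in>A. \<forall>T'\<in>A. share_facet T T' \<longrightarrow> c T \<noteq> c T')"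
    if "finite A" "A \<subseteq> S" for A
  proof (rule finite_degenerate_coloring[OF that(1) sym])
    show "\<exists>T\<in>B. card {T' \<in> B. share_facet T T'} < CARD('n) + 1" if "B \<subseteq> A" "B \<noteq> {}" for B
      using that \<open>finite A\<close> \<open>A \<subseteq> S\<close>
      by (intro simplex_complex_low_degree[OF assms]) (auto intro: finite_subset)
  qed (auto simp: share_facet_def)
  then obtain c :: "(real ^ 'n) set \<Rightarrow> nat" where c: "\<forall>T\<in>S. c T < CARD('n) + 1"
      "\<forall>T\<in>S. \<forall>T'\<in>S. share_facet T T' \<longrightarrow> c T \<noteq> c T'"
    using de_Bruijn_Erdos[of S "CARD('n) + 1" share_facet] by blast
  \<comment> \<open>An edge is an unordered pair, so \<open>{u, v}\<close> may match
    \<open>T\<close> and \<open>T'\<close> in either order; inequality of colours is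
    symmetric.\<close>
  have "proper_coloring (dual_graph S) (CARD('n) + 1) c"
    unfolding proper_coloring_def dual_graph_def using c by (fastforce simp: doubleton_eq_iff)
  then have "chromatic_number (dual_graph S) \<le> enat (CARD('n) + 1)"
    unfolding chromatic_number_def by (blast intro: Inf_lower)
  then show ?thesis
    using c by blast
qed

end
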